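(* Let $H\in M_6(\mathbb C)$ be a self-adjoint complex Hadamard matrix, i.e. a complex Hadamard matrix with $H=H^*$. Then $H$ is equivalent to $H(\theta)$ for some $\theta\in \left[-\pi,-\arccos\left(\frac{-1+\sqrt{3}}{2}\right)\right]\cup \left[\arccos\left(\frac{-1+\sqrt{3}}{2}\right),\pi\right]$, where $$H(\theta)=\begin{pmatrix} 1 & 1 & 1 & 1 & 1 & 1 \\ 1 & -1 & \bar{x} &-y &-\bar{x} &y \\ 1 & x & -1 & t & -t & -x \\ 1 &-\bar{y} & \bar{t} & -1 & \bar{y} &-\bar{t} \\ 1 &-x & -\bar{t} & y & 1 &\bar{z} \\ 1 & \bar{y} &-\bar{x} &-t & z & 1 \end{pmatrix}$$ and the parameters $x,y,z,t$ are given by $$y=\exp(i\theta),\qquad z=\frac{1+2y-y^2}{y(-1+2y+y^2)},$$ $$x=\frac{1+2y+y^2-\sqrt{2}\sqrt{1+2y+2y^3+y^4}}{1+2y-y^2},$$ $$t=\frac{1+2y+y^2-\sqrt{2}\sqrt{1+2y+2y^3+y^4}}{-1+2y+y^2}.$$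
   Context: A complex Hadamard matrix of order $n$ is a matrix $H\in M_n(\mathbb C)$ all of whose entries have absolute value $1$ and such that $\frac{1}{\sqrt n}H$ is unitary. $H^*$ denotes the conjugate transpose of $H$. Two complex Hadamard matrices $H_1,H_2$ of the same order are equivalent if there exist unitary diagonal matrices $D_1,D_2$ and permutation matrices $P_1,P_2$ such that $H_2=P_1D_1H_1D_2P_2$. The square root of a complex number denotes the principal value of $w\mapsto w^{1/2}$ (argument of $w$ taken in $(-\pi,\pi]$). *)

theory Defs
  imports "Jordan_Normal_Form.Schur_Decomposition" "HOL-Combinatorics.Permutations"
begin

definition unitary_mat :: "nat \<Rightarrow> complex mat \<Rightarrow> bool" where
  "unitary_mat n U \<longleftrightarrow>
     U \<in> carrier_mat n n \<and> U * mat_adjoint U = 1\<^sub>m n \<and> mat_adjoint U * U = 1\<^sub>m n"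

definition permutation_mat :: "nat \<Rightarrow> complex mat \<Rightarrow> bool" where
  "permutation_mat n P \<longleftrightarrow>
     (\<exists>\<sigma>. \<sigma> permutes {..<n} \<and> P = mat n n (\<lambda>(i, j). if i = \<sigma> j then 1 else 0))"

definition complex_hadamard :: "nat \<Rightarrow> complex mat \<Rightarrow> bool" where
  "complex_hadamard n H \<longleftrightarrow>
     H \<in> carrier_mat n n \<and>
     (\<forall>i<n. \<forall>j<n. cmod (H $$ (i, j)) = 1) \<and>
     unitary_mat n (complex_of_real (1 / sqrt (real n)) \<cdot>\<^sub>m H)"

definition hadamard_equiv :: "nat \<Rightarrow> complex mat \<Rightarrow> complex mat \<Rightarrow> bool" where
  "hadamard_equiv n H\<^sub>1 H\<^sub>2 \<longleftrightarrow>
     complex_hadamard n H\<^sub>1 \<and> complex_hadamard n H\<^sub>2 \<and>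
     (\<exists>D\<^sub>1 D\<^sub>2 P\<^sub>1 P\<^sub>2.
        unitary_mat n D\<^sub>1 \<and> diagonal_mat D\<^sub>1 \<and> unitary_mat n D\<^sub>2 \<and> diagonal_mat D\<^sub>2 \<and>
        permutation_mat n P\<^sub>1 \<and> permutation_mat n P\<^sub>2 \<and>
        H\<^sub>2 = P\<^sub>1 * D\<^sub>1 * H\<^sub>1 * D\<^sub>2 * P\<^sub>2)"

definition par_y :: "real \<Rightarrow> complex" where
  "par_y \<theta> = exp (\<i> * complex_of_real \<theta>)"

(* The two denominators 1 + 2y - y^2 and -1 + 2y + y^2 below never vanish for |y| = 1: they are
   2y(1 - i sin \<theta>) and 2y(1 + i sin \<theta>).  The library function csqrt is the principal square root,
   with csqrt (-1) = i. *)

definition par_z :: "real \<Rightarrow> complex" where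
  "par_z \<theta> = (let y = par_y \<theta> in (1 + 2 * y - y\<^sup>2) / (y * (- 1 + 2 * y + y\<^sup>2)))"

definition par_x :: "real \<Rightarrow> complex" where
  "par_x \<theta> = (let y = par_y \<theta> in
     (1 + 2 * y + y\<^sup>2 - complex_of_real (sqrt 2) * csqrt (1 + 2 * y + 2 * y ^ 3 + y ^ 4))
       / (1 + 2 * y - y\<^sup>2))"

definition par_t :: "real \<Rightarrow> complex" where
  "par_t \<theta> = (let y = par_y \<theta> in
     (1 + 2 * y + y\<^sup>2 - complex_of_real (sqrt 2) * csqrt (1 + 2 * y + 2 * y ^ 3 + y ^ 4))
       / (- 1 + 2 * y + y\<^sup>2))"

definition H_family :: "real \<Rightarrow> complex mat" where
  "H_family \<theta> =
     (let x = par_x \<theta>; y = par_y \<theta>; z = par_z \<theta>; t = par_t \<theta> in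
      mat_of_rows_list 6
       [[1,       1,       1,       1,       1,       1],
        [1,     - 1,   cnj x,     - y, - cnj x,       y],
        [1,       x,     - 1,       t,     - t,     - x],
        [1, - cnj y,   cnj t,     - 1,   cnj y, - cnj t],
        [1,     - x, - cnj t,       y,       1,   cnj z],
        [1,   cnj y, - cnj x,     - t,       z,       1]])"

end

theory Submission
  imports Defs
begin

text \<open>
  A self-adjoint Hadamard matrix \<open>H\<close> of order \<open>6\<close> satisfies \<open>H\<^sup>2 = 6\<close>, so its trace is an integer
  multiple of \<open>\<surd>6\<close>. Its diagonal entries are \<open>\<plusminus>1\<close>, so the trace is also an integer and must vanish
  (\<open>selfadjoint_hadamard_trace\<close>): exactly three diagonal entries are \<open>-1\<close>. A permutation and a
  conjugation by a unitary diagonal matrix make the diagonal \<open>1, -1, -1, -1, 1, 1\<close> and the first row and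
  column constant \<open>1\<close>, while \<open>H\<close> stays self-adjoint.

  Now each of the three rows with diagonal entry \<open>-1\<close> is orthogonal to the all-ones row. Its entries
  \<open>1\<close> and \<open>-1\<close> cancel, so its other four entries have sum zero, and four unimodular numbers with sum
  zero split into two opposite pairs (\<open>four_units_sum_zero\<close>). That leaves three patterns for each of
  the three rows. The remaining orthogonality relations exclude one pattern altogether
  (\<open>no_opposite_first_pair\<close>) and force the other two to be used coherently
  (\<open>mixed_orientation\<close>, \<open>cyclic_pattern\<close>). What survives is exactly the shape of the family, with
  unknown unimodular entries \<open>x, y, z, t\<close> (\<open>cyclic_matrix\<close>).

  For this shape, write \<open>y = c + \<i>s\<close>. Orthogonality forces
  \<open>x (1 - \<i>s) = t (1 + \<i>s) = U\<close> where \<open>U = 1 + c \<plusminus> \<i> \<surd>(1 - 2c - 2c\<^sup>2)\<close>, together with the formula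
  for \<open>z\<close> (\<open>cyclic_solution\<close>). Nonnegativity of the radicand is the bound on \<open>\<theta>\<close>. The principal
  square root in the family picks one of the two signs of \<open>Im U\<close>, and the other sign is reached by
  symmetries of the shape: interchanging two of the three negative indices, and also the last two indices,
  replaces \<open>y\<close> by its conjugate and keeps \<open>U\<close>; at \<open>y = -1\<close>, which conjugation fixes,
  a cyclic shift of the three negative indices leads to \<open>\<theta> = \<pi>/2\<close> (\<open>cyclic_matrix_equiv_H_family\<close>).
\<close>

section \<open>Hadamard matrices by entries\<close>

lemma sum_mult_delta:
  fixes f :: "nat \<Rightarrow> complex"
  assumes "m < n"
  shows "(\<Sum>k = 0..<n. (if k = m then c else 0) * f k) = c * f m"
    and "(\<Sum>k = 0..<n. f k * (if k = m then c else 0)) = f m * c"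
  using assms by (auto simp: if_distrib[of "\<lambda>u. u * _"] if_distrib[of "\<lambda>u. _ * u"] cong: if_cong)

lemma index_mult_mat_sum:
  assumes "A \<in> carrier_mat n m" "B \<in> carrier_mat m l" "i < n" "j < l"
  shows "(A * B) $$ (i, j) = (\<Sum>k = 0..<m. A $$ (i, k) * B $$ (k, j))"
  using assms by (auto simp: scalar_prod_def intro!: sum.cong)

lemma mat_adjoint_carrier: "A \<in> carrier_mat n m \<Longrightarrow> mat_adjoint A \<in> carrier_mat m n"
  by (auto simp: mat_adjoint_def)

lemma mat_adjoint_index:
  assumes "A \<in> carrier_mat n m" "i < m" "j < n"
  shows "mat_adjoint A $$ (i, j) = cnj (A $$ (j, i))"
  using assms by (auto simp: mat_adjoint_def mat_of_rows_def)

lemma mult_mat_adjoint_index: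
  assumes A: "A \<in> carrier_mat n n" and "i < n" "j < n"
  shows "(A * mat_adjoint A) $$ (i, j) = (\<Sum>k = 0..<n. A $$ (i, k) * cnj (A $$ (j, k)))"
  unfolding index_mult_mat_sum[OF A mat_adjoint_carrier[OF A] assms(2,3)]
  using assms by (intro sum.cong) (auto simp: mat_adjoint_index[OF A])

lemma unitary_matI:
  assumes A: "A \<in> carrier_mat n n"
    and "\<And>i j. i < n \<Longrightarrow> j < n \<Longrightarrow>
      (\<Sum>k = 0..<n. A $$ (i, k) * cnj (A $$ (j, k))) = (if i = j then 1 else 0)"
  shows "unitary_mat n A"
proof -
  have "A * mat_adjoint A = 1\<^sub>m n"
    using A by (intro eq_matI)
      (auto simp: mult_mat_adjoint_index[OF A] assms(2) mat_adjoint_carrier[OF A, THEN carrier_matD(2)]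
         simp del: index_mult_mat(1))
  then show ?thesis
    using mat_mult_left_right_inverse[OF A mat_adjoint_carrier[OF A]] A
    by (simp add: unitary_mat_def)
qed

lemma unitary_mat_diag:
  assumes "\<And>i. i < n \<Longrightarrow> cmod (d i) = 1"
  shows "unitary_mat n (mat n n (\<lambda>(i, j). if j = i then d i else 0))" (is "unitary_mat n ?D")
    and "diagonal_mat (mat n n (\<lambda>(i, j). if j = i then d i else 0))"
proof -
  show "unitary_mat n ?D"
  proof (rule unitary_matI)
    fix i j assume ij: "i < n" "j < n"
    have "(\<Sum>k = 0..<n. ?D $$ (i, k) * cnj (?D $$ (j, k)))
        = (\<Sum>k = 0..<n. (if k = i then d i else 0) * cnj (if k = j then d j else 0))"
      using ij by (intro sum.cong) auto
    also have "\<dots> = d i * cnj (if i = j then d j else 0)"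
      using sum_mult_delta(1)[OF ij(1)] by simp
    also have "\<dots> = (if i = j then 1 else 0)"
      using assms ij by (auto simp: complex_norm_square[symmetric])
    finally show "(\<Sum>k = 0..<n. ?D $$ (i, k) * cnj (?D $$ (j, k))) = (if i = j then 1 else 0)" .
  qed simp
qed (auto simp: diagonal_mat_def)

text \<open>
  A one-sided inverse of a square matrix is two-sided, so orthogonality of the rows already makes the
  scaled matrix unitary.
\<close>
lemma complex_hadamard_iff:
  "complex_hadamard n A \<longleftrightarrow> A \<in> carrier_mat n n \<and> (\<forall>i<n. \<forall>j<n. cmod (A $$ (i, j)) = 1) \<and>
     (\<forall>i<n. \<forall>j<n. (\<Sum>k = 0..<n. A $$ (i, k) * cnj (A $$ (j, k))) = (if i = j then of_nat n else 0))"
proof (cases "A \<in> carrier_mat n n")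
  case A: True
  define c where "c = complex_of_real (1 / sqrt (real n))"
  have c: "c * cnj c * of_nat n = 1" if "n > 0"
  proof -
    have "c * cnj c * of_nat n = of_real ((1 / sqrt (real n)) * (1 / sqrt (real n)) * real n)"
      by (simp only: c_def complex_cnj_complex_of_real of_real_mult of_real_of_nat_eq)
    also have "(1 / sqrt (real n)) * (1 / sqrt (real n)) * real n = 1" using that by simp
    finally show ?thesis by simp
  qed
  have cA: "c \<cdot>\<^sub>m A \<in> carrier_mat n n" using A by simp
  have S: "(\<Sum>k = 0..<n. (c \<cdot>\<^sub>m A) $$ (i, k) * cnj ((c \<cdot>\<^sub>m A) $$ (j, k)))
      = c * cnj c * (\<Sum>k = 0..<n. A $$ (i, k) * cnj (A $$ (j, k)))" if "i < n" "j < n" for i j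
    using that A by (auto simp: sum_distrib_left intro!: sum.cong)
  have "unitary_mat n (c \<cdot>\<^sub>m A) \<longleftrightarrow>
    (\<forall>i<n. \<forall>j<n. (\<Sum>k = 0..<n. A $$ (i, k) * cnj (A $$ (j, k))) = (if i = j then of_nat n else 0))"
    (is "_ \<longleftrightarrow> ?R")
  proof
    assume U: "unitary_mat n (c \<cdot>\<^sub>m A)"
    show ?R
    proof (intro allI impI)
      fix i j assume ij: "i < n" "j < n"
      have "((c \<cdot>\<^sub>m A) * mat_adjoint (c \<cdot>\<^sub>m A)) $$ (i, j) = 1\<^sub>m n $$ (i, j)"
        using U by (simp add: unitary_mat_def)
      then have 1: "c * cnj c * (\<Sum>k = 0..<n. A $$ (i, k) * cnj (A $$ (j, k))) = (if i = j then 1 else 0)"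
        using ij S[OF ij] by (simp add: mult_mat_adjoint_index[OF cA] del: index_mult_mat(1) index_smult_mat(1))
      have "(\<Sum>k = 0..<n. A $$ (i, k) * cnj (A $$ (j, k)))
          = (c * cnj c * of_nat n) * (\<Sum>k = 0..<n. A $$ (i, k) * cnj (A $$ (j, k)))"
        using c ij by simp
      also have "\<dots> = of_nat n * (c * cnj c * (\<Sum>k = 0..<n. A $$ (i, k) * cnj (A $$ (j, k))))"
        by (simp only: mult_ac)
      finally show "(\<Sum>k = 0..<n. A $$ (i, k) * cnj (A $$ (j, k))) = (if i = j then of_nat n else 0)"
        using 1 by simp
    qed
  next
    assume R: ?R
    show "unitary_mat n (c \<cdot>\<^sub>m A)"
      by (rule unitary_matI[OF cA]) (use R S c in auto)
  qed
  then show ?thesis using A by (auto simp: complex_hadamard_def c_def)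
qed (simp add: complex_hadamard_def)

section \<open>Equivalence by monomial matrices\<close>

text \<open>
  Multiplying on each side by a permutation and a unitary diagonal matrix permutes and rescales the
  entries. In this form, equivalences compose and can be checked entry by entry.
\<close>
definition monomially_equiv :: "nat \<Rightarrow> complex mat \<Rightarrow> complex mat \<Rightarrow> bool" where
  "monomially_equiv n A B \<longleftrightarrow> (\<exists>\<sigma> \<tau> a b. \<sigma> permutes {..<n} \<and> \<tau> permutes {..<n} \<and>
     (\<forall>i<n. cmod (a i) = 1 \<and> cmod (b i) = 1) \<and>
     B = mat n n (\<lambda>(i, j). a i * A $$ (\<sigma> i, \<tau> j) * b j))"

lemma monomially_equiv_trans:
  assumes "monomially_equiv n A B" "monomially_equiv n B C"
  shows "monomially_equiv n A C"
proof -
  obtain \<sigma> \<tau> a b where 1: "\<sigma> permutes {..<n}" "\<tau> permutes {..<n}"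
    "\<forall>i<n. cmod (a i) = 1 \<and> cmod (b i) = 1" "B = mat n n (\<lambda>(i, j). a i * A $$ (\<sigma> i, \<tau> j) * b j)"
    using assms(1) by (auto simp: monomially_equiv_def)
  obtain \<sigma>' \<tau>' a' b' where 2: "\<sigma>' permutes {..<n}" "\<tau>' permutes {..<n}"
    "\<forall>i<n. cmod (a' i) = 1 \<and> cmod (b' i) = 1" "C = mat n n (\<lambda>(i, j). a' i * B $$ (\<sigma>' i, \<tau>' j) * b' j)"
    using assms(2) by (auto simp: monomially_equiv_def)
  have lt: "\<sigma>' i < n" "\<tau>' i < n" if "i < n" for i
    using that 2(1,2) permutes_in_image[of \<sigma>'] permutes_in_image[of \<tau>'] by auto
  have "C = mat n n (\<lambda>(i, j). (a' i * a (\<sigma>' i)) * A $$ ((\<sigma> \<circ> \<sigma>') i, (\<tau> \<circ> \<tau>') j) * (b (\<tau>' j) * b' j))"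
    using 1(4) 2(4) by (intro eq_matI) (auto simp: lt algebra_simps)
  moreover have "\<forall>i<n. cmod (a' i * a (\<sigma>' i)) = 1 \<and> cmod (b (\<tau>' i) * b' i) = 1"
    using 1(3) 2(3) lt by (auto simp: norm_mult)
  moreover have "(\<sigma> \<circ> \<sigma>') permutes {..<n}" "(\<tau> \<circ> \<tau>') permutes {..<n}"
    using 1 2 by (auto intro: permutes_compose)
  ultimately show ?thesis unfolding monomially_equiv_def
    by (intro exI[of _ "\<sigma> \<circ> \<sigma>'"] exI[of _ "\<tau> \<circ> \<tau>'"]
        exI[of _ "\<lambda>i. a' i * a (\<sigma>' i)"] exI[of _ "\<lambda>i. b (\<tau>' i) * b' i"]) simp
qed

lemma complex_hadamard_monomial:
  assumes "complex_hadamard n A" "monomially_equiv n A B"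
  shows "complex_hadamard n B"
proof -
  obtain \<sigma> \<tau> a b where m: "\<sigma> permutes {..<n}" "\<tau> permutes {..<n}"
    "\<forall>i<n. cmod (a i) = 1 \<and> cmod (b i) = 1" and B: "B = mat n n (\<lambda>(i, j). a i * A $$ (\<sigma> i, \<tau> j) * b j)"
    using assms(2) by (auto simp: monomially_equiv_def)
  have lt: "\<sigma> i < n" "\<tau> i < n" if "i < n" for i
    using that m(1,2) permutes_in_image[of \<sigma>] permutes_in_image[of \<tau>] by auto
  have A: "\<And>i j. i < n \<Longrightarrow> j < n \<Longrightarrow> cmod (A $$ (i, j)) = 1"
    "\<And>i j. i < n \<Longrightarrow> j < n \<Longrightarrow>
       (\<Sum>k = 0..<n. A $$ (i, k) * cnj (A $$ (j, k))) = (if i = j then of_nat n else 0)"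
    using assms(1) by (auto simp: complex_hadamard_iff)
  have "(\<Sum>k = 0..<n. B $$ (i, k) * cnj (B $$ (j, k))) = (if i = j then of_nat n else 0)"
    if ij: "i < n" "j < n" for i j
  proof -
    have bb: "b k * cnj (b k) = 1" if "k < n" for k
      using m(3) that by (simp add: complex_norm_square[symmetric])
    have "(\<Sum>k = 0..<n. B $$ (i, k) * cnj (B $$ (j, k)))
      = (\<Sum>k = 0..<n. a i * cnj (a j) * (A $$ (\<sigma> i, \<tau> k) * cnj (A $$ (\<sigma> j, \<tau> k))) * (b k * cnj (b k)))"
      using ij by (intro sum.cong) (auto simp: B)
    also have "\<dots> = (\<Sum>k = 0..<n. a i * cnj (a j) * (A $$ (\<sigma> i, \<tau> k) * cnj (A $$ (\<sigma> j, \<tau> k))))"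
      by (intro sum.cong refl) (simp add: bb del: complex_cnj_mult)
    also have "\<dots> = a i * cnj (a j) * (\<Sum>k = 0..<n. A $$ (\<sigma> i, \<tau> k) * cnj (A $$ (\<sigma> j, \<tau> k)))"
      by (simp add: sum_distrib_left)
    also have "(\<Sum>k = 0..<n. A $$ (\<sigma> i, \<tau> k) * cnj (A $$ (\<sigma> j, \<tau> k)))
      = (\<Sum>k = 0..<n. A $$ (\<sigma> i, k) * cnj (A $$ (\<sigma> j, k)))"
      using sum.permute[OF m(2), of "\<lambda>k. A $$ (\<sigma> i, k) * cnj (A $$ (\<sigma> j, k))"]
      by (simp add: lessThan_atLeast0 comp_def)
    also have "\<dots> = (if i = j then of_nat n else 0)"
      using A(2)[OF lt(1)[OF ij(1)] lt(1)[OF ij(2)]] permutes_inj[OF m(1)] by (simp add: inj_eq)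
    finally show ?thesis
      using m(3) ij by (auto simp: complex_norm_square[symmetric])
  qed
  then show ?thesis
    using A(1) m(3) lt by (auto simp: complex_hadamard_iff B norm_mult)
qed

text \<open>
  The matrix products act on the left by \<open>(P\<^sub>1 A)(i, j) = A(\<sigma> i, j)\<close> and on the right by
  \<open>(A P\<^sub>2)(i, j) = A(i, \<tau> j)\<close>. Hence \<open>P\<^sub>1\<close> is the matrix of the inverse of \<open>\<sigma>\<close> while \<open>P\<^sub>2\<close> is the matrix
  of \<open>\<tau>\<close>, and the scalars have to be relabelled because the diagonal matrices are applied before the
  permutations.
\<close>
lemma hadamard_equiv_monomial:
  assumes had: "complex_hadamard n A" and eq: "monomially_equiv n A B"
  shows "hadamard_equiv n A B"
proof -
  obtain \<sigma> \<tau> a b where m: "\<sigma> permutes {..<n}" "\<tau> permutes {..<n}"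
    "\<forall>i<n. cmod (a i) = 1 \<and> cmod (b i) = 1" and B: "B = mat n n (\<lambda>(i, j). a i * A $$ (\<sigma> i, \<tau> j) * b j)"
    using eq by (auto simp: monomially_equiv_def)
  have A: "A \<in> carrier_mat n n" using had by (simp add: complex_hadamard_def)
  have lt: "\<sigma> i < n" "\<tau> i < n" "inv_into UNIV \<sigma> i < n" "inv_into UNIV \<tau> i < n" if "i < n" for i
    using that permutes_in_image[OF m(1), of i] permutes_in_image[OF m(2), of i]
      permutes_in_image[OF permutes_inv[OF m(1)], of i] permutes_in_image[OF permutes_inv[OF m(2)], of i]
    by simp_all
  define P1 where "P1 = mat n n (\<lambda>(i, j). if i = inv_into UNIV \<sigma> j then 1 else (0::complex))"
  define P2 where "P2 = mat n n (\<lambda>(i, j). if i = \<tau> j then 1 else (0::complex))"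
  define D1 where "D1 = mat n n (\<lambda>(i, j). if j = i then a (inv_into UNIV \<sigma> i) else 0)"
  define D2 where "D2 = mat n n (\<lambda>(i, j). if j = i then b (inv_into UNIV \<tau> i) else 0)"
  note carr = P1_def P2_def D1_def D2_def
  have s: "i = inv_into UNIV \<sigma> k \<longleftrightarrow> k = \<sigma> i" for i k
    using permutes_inverses[OF m(1)] by auto
  have 1: "P1 * D1 = mat n n (\<lambda>(i, j). if j = \<sigma> i then a i else 0)" (is "_ = ?M1")
  proof (rule eq_matI)
    fix i j assume "i < dim_row ?M1" "j < dim_col ?M1"
    then have ij: "i < n" "j < n" by auto
    have "(P1 * D1) $$ (i, j) = (\<Sum>k = 0..<n. (if k = \<sigma> i then 1 else 0) * D1 $$ (k, j))"
      using ij by (subst index_mult_mat_sum[of _ n n _ n]) (auto simp: carr s intro!: sum.cong)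
    also have "\<dots> = D1 $$ (\<sigma> i, j)"
      using sum_mult_delta(1)[OF lt(1)[OF ij(1)]] by simp
    finally show "(P1 * D1) $$ (i, j) = ?M1 $$ (i, j)"
      using ij lt m(1) by (simp add: D1_def permutes_inverses)
  qed (auto simp: carr)
  have 2: "P1 * D1 * A = mat n n (\<lambda>(i, j). a i * A $$ (\<sigma> i, j))" (is "_ = ?M2")
  proof (rule eq_matI)
    fix i j assume "i < dim_row ?M2" "j < dim_col ?M2"
    then have ij: "i < n" "j < n" by auto
    have "(P1 * D1 * A) $$ (i, j) = (\<Sum>k = 0..<n. (if k = \<sigma> i then a i else 0) * A $$ (k, j))"
      unfolding 1 using ij A by (subst index_mult_mat_sum[of _ n n _ n]) (auto intro!: sum.cong)
    then show "(P1 * D1 * A) $$ (i, j) = ?M2 $$ (i, j)"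
      using ij sum_mult_delta(1)[OF lt(1)[OF ij(1)]] by simp
  qed (use A in \<open>auto simp: carr\<close>)
  have 3: "P1 * D1 * A * D2 = mat n n (\<lambda>(i, j). a i * A $$ (\<sigma> i, j) * b (inv_into UNIV \<tau> j))" (is "_ = ?M3")
  proof (rule eq_matI)
    fix i j assume "i < dim_row ?M3" "j < dim_col ?M3"
    then have ij: "i < n" "j < n" by auto
    have "(P1 * D1 * A * D2) $$ (i, j)
      = (\<Sum>k = 0..<n. (a i * A $$ (\<sigma> i, k)) * (if k = j then b (inv_into UNIV \<tau> j) else 0))"
      unfolding 2 using ij by (subst index_mult_mat_sum[of _ n n _ n]) (auto simp: carr intro!: sum.cong)
    then show "(P1 * D1 * A * D2) $$ (i, j) = ?M3 $$ (i, j)"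
      using ij sum_mult_delta(2)[OF ij(2)] by simp
  qed (auto simp: carr)
  have 4: "P1 * D1 * A * D2 * P2 = B"
  proof (rule eq_matI)
    fix i j assume "i < dim_row B" "j < dim_col B"
    then have ij: "i < n" "j < n" by (auto simp: B)
    have "(P1 * D1 * A * D2 * P2) $$ (i, j)
      = (\<Sum>k = 0..<n. (a i * A $$ (\<sigma> i, k) * b (inv_into UNIV \<tau> k)) * (if k = \<tau> j then 1 else 0))"
      unfolding 3 using ij by (subst index_mult_mat_sum[of _ n n _ n]) (auto simp: carr intro!: sum.cong)
    then show "(P1 * D1 * A * D2 * P2) $$ (i, j) = B $$ (i, j)"
      using ij sum_mult_delta(2)[OF lt(2)[OF ij(2)]] m(2) by (simp add: B permutes_inverses)
  qed (auto simp: carr B)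
  have D: "unitary_mat n D1" "diagonal_mat D1" "unitary_mat n D2" "diagonal_mat D2"
    unfolding D1_def D2_def by (intro unitary_mat_diag; use m(3) lt in simp)+
  have P1: "permutation_mat n P1"
    unfolding permutation_mat_def P1_def using permutes_inv[OF m(1)]
    by (intro exI[of _ "inv_into UNIV \<sigma>"]) simp
  have P2: "permutation_mat n P2"
    unfolding permutation_mat_def P2_def using m(2)
    by (intro exI[of _ \<tau>]) simp
  show ?thesis
    unfolding hadamard_equiv_def using had complex_hadamard_monomial[OF had eq] D P1 P2 4[symmetric]
    by (intro exI[of _ D1] exI[of _ D2] exI[of _ P1] exI[of _ P2] conjI)
qed

section \<open>The trace of a self-adjoint Hadamard matrix\<close>

lemma trace_mult_commute:
  fixes A B :: "complex mat"
  assumes "A \<in> carrier_mat n m" "B \<in> carrier_mat m n"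
  shows "(\<Sum>i = 0..<n. (A * B) $$ (i, i)) = (\<Sum>k = 0..<m. (B * A) $$ (k, k))"
proof -
  have "(\<Sum>i = 0..<n. (A * B) $$ (i, i)) = (\<Sum>i = 0..<n. \<Sum>k = 0..<m. A $$ (i, k) * B $$ (k, i))"
    using assms by (intro sum.cong) (auto simp: index_mult_mat_sum simp del: index_mult_mat(1))
  also have "\<dots> = (\<Sum>k = 0..<m. \<Sum>i = 0..<n. B $$ (k, i) * A $$ (i, k))"
    by (subst sum.swap) (simp add: mult.commute)
  also have "\<dots> = (\<Sum>k = 0..<m. (B * A) $$ (k, k))"
    using assms by (intro sum.cong) (auto simp: index_mult_mat_sum simp del: index_mult_mat(1))
  finally show ?thesis .
qed

text \<open>
  Triangularise \<open>A\<close>: the diagonal of a triangular square root of \<open>c\<^sup>2\<close> times the identity consists of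
  entries \<open>c\<close> and \<open>-c\<close>, and the trace is invariant under similarity.
\<close>
lemma trace_of_square_root_of_scalar:
  fixes A :: "complex mat"
  assumes A: "A \<in> carrier_mat n n" and sq: "A * A = (c\<^sup>2) \<cdot>\<^sub>m 1\<^sub>m n"
  shows "\<exists>m::int. (\<Sum>i = 0..<n. A $$ (i, i)) = of_int m * c"
proof -
  obtain es where "char_poly A = (\<Prod>a\<leftarrow>es. [:- a, 1:])"
    using char_poly_factorized[OF A] by blast
  then obtain B where B: "B \<in> carrier_mat n n" and tri: "upper_triangular B" and "similar_mat A B"
    using schur_decomposition_exists[OF A] by blast
  then obtain P Q where "similar_mat_wit A B P Q" by (auto simp: similar_mat_def)
  note w = similar_mat_witD2[OF A this]
  have c: "P * (B * Q) \<in> carrier_mat n n" using w by auto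
  have "(\<Sum>i = 0..<n. A $$ (i, i)) = (\<Sum>i = 0..<n. (P * (B * Q)) $$ (i, i))"
    using w by simp
  also have "\<dots> = (\<Sum>i = 0..<n. (B * Q * P) $$ (i, i))"
    by (rule trace_mult_commute) (use w in auto)
  also have "B * Q * P = B" using w by simp
  finally have tr: "(\<Sum>i = 0..<n. A $$ (i, i)) = (\<Sum>i = 0..<n. B $$ (i, i))" .
  have "B = Q * A * P" by (rule similar_mat_witD2(3)[OF w(5) similar_mat_wit_sym[OF \<open>similar_mat_wit A B P Q\<close>]])
  then have "B * B = Q * A * P * (Q * A * P)" by simp
  also have "\<dots> = Q * A * (P * Q) * A * P"
    using w by (simp add: assoc_mult_mat[of _ n n _ n _ n])
  also have "\<dots> = Q * (A * A) * P"
    using w by (simp add: assoc_mult_mat[of _ n n _ n _ n])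
  also have "\<dots> = (c\<^sup>2) \<cdot>\<^sub>m 1\<^sub>m n" unfolding sq
    using w by (simp add: mult_smult_distrib[of _ n n _ n] mult_smult_assoc_mat[of _ n n _ n])
  finally have BB: "B * B = (c\<^sup>2) \<cdot>\<^sub>m 1\<^sub>m n" .
  have "\<exists>s::int. B $$ (i, i) = of_int s * c" if i: "i < n" for i
  proof -
    have "c\<^sup>2 = (B * B) $$ (i, i)" unfolding BB using i by simp
    also have "\<dots> = (\<Sum>k = 0..<n. B $$ (i, k) * B $$ (k, i))"
      by (rule index_mult_mat_sum[OF B B i i])
    also have "\<dots> = (\<Sum>k = 0..<n. if k = i then (B $$ (i, i))\<^sup>2 else 0)"
    proof (intro sum.cong refl)
      fix k assume "k \<in> {0..<n}"
      then show "B $$ (i, k) * B $$ (k, i) = (if k = i then (B $$ (i, i))\<^sup>2 else 0)"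
        using i tri B upper_triangularD[of B] by (cases k i rule: linorder_cases) (auto simp: power2_eq_square)
    qed
    also have "\<dots> = (B $$ (i, i))\<^sup>2" using i by simp
    finally have "B $$ (i, i) = c \<or> B $$ (i, i) = - c" by (auto simp: power2_eq_iff)
    then show ?thesis by (auto intro: exI[of _ 1] exI[of _ "-1"])
  qed
  then obtain s :: "nat \<Rightarrow> int" where "\<And>i. i < n \<Longrightarrow> B $$ (i, i) = of_int (s i) * c" by metis
  then show ?thesis
    by (intro exI[of _ "\<Sum>i = 0..<n. s i"]) (simp add: tr sum_distrib_right)
qed

text \<open>
  The trace is an integer multiple of \<open>\<surd>n\<close>, and it is an integer because the diagonal entries are
  real of modulus one. For \<open>n\<close> not a square both can hold only if it is zero.
\<close>
lemma selfadjoint_hadamard_trace: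
  assumes had: "complex_hadamard n A" and adj: "mat_adjoint A = A" and n: "\<not> (\<exists>k. n = k\<^sup>2)"
  shows "(\<Sum>i = 0..<n. A $$ (i, i)) = 0"
proof -
  have A: "A \<in> carrier_mat n n" using had by (simp add: complex_hadamard_def)
  have "A * A = A * mat_adjoint A" using adj by simp
  also have "\<dots> = ((of_real (sqrt (real n)))\<^sup>2) \<cdot>\<^sub>m 1\<^sub>m n"
    using A mat_adjoint_carrier[OF A] had
    by (intro eq_matI) (auto simp: mult_mat_adjoint_index[OF A] complex_hadamard_iff
        simp flip: of_real_power simp del: index_mult_mat(1))
  finally obtain m :: int where m: "(\<Sum>i = 0..<n. A $$ (i, i)) = of_int m * of_real (sqrt (real n))"
    using trace_of_square_root_of_scalar[OF A] by blast
  have "\<exists>s::int. A $$ (i, i) = of_int s" if "i < n" for i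
  proof -
    have "cnj (A $$ (i, i)) = A $$ (i, i)" "cmod (A $$ (i, i)) = 1"
      using mat_adjoint_index[OF A that that] adj had that by (auto simp: complex_hadamard_def)
    then obtain r where r: "A $$ (i, i) = of_real r" by (auto simp: Reals_cnj_iff[symmetric] elim: Reals_cases)
    then have "r = 1 \<or> r = - 1" using \<open>cmod (A $$ (i, i)) = 1\<close> by auto
    then show ?thesis using r by (auto intro: exI[of _ 1] exI[of _ "-1"])
  qed
  then obtain s :: "nat \<Rightarrow> int" where s: "\<And>i. i < n \<Longrightarrow> A $$ (i, i) = of_int (s i)" by metis
  define t where "t = (\<Sum>i = 0..<n. s i)"
  have "of_int t = (\<Sum>i = 0..<n. A $$ (i, i))" using s by (simp add: t_def)
  then have "complex_of_real (of_int t) = of_real (of_int m * sqrt (real n))" using m by simp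
  then have "real_of_int t = of_int m * sqrt (real n)" by (simp only: of_real_eq_iff)
  then have "(real_of_int t)\<^sup>2 = (of_int m)\<^sup>2 * real n" by (simp add: power_mult_distrib)
  then have "real_of_int (t\<^sup>2) = of_int (m\<^sup>2 * int n)" by simp
  then have eq: "t\<^sup>2 = m\<^sup>2 * int n" by (simp only: of_int_eq_iff)
  have "m = 0"
  proof (rule ccontr)
    assume "m \<noteq> 0"
    have "m\<^sup>2 dvd t\<^sup>2" using eq by simp
    then have "m dvd t" by simp
    then obtain k where "t = m * k" ..
    then have "int n = k\<^sup>2" using eq \<open>m \<noteq> 0\<close> by (simp add: power_mult_distrib)
    then have "int n = int ((nat \<bar>k\<bar>)\<^sup>2)" by simp
    then have "n = (nat \<bar>k\<bar>)\<^sup>2" by (simp only: of_nat_eq_iff)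
    with n show False by blast
  qed
  then show ?thesis using m by simp
qed

section \<open>Unimodular numbers\<close>

text \<open>
  Conjugation inverts a unimodular number. From \<open>s = - (p + q + r)\<close> and
  \<open>1/s = - (1/p + 1/q + 1/r)\<close> one gets \<open>(p + q + r) (q r + p r + p q) = p q r\<close>, that is,
  \<open>(p + q) (p + r) (q + r) = 0\<close>.
\<close>
lemma four_units_sum_zero:
  fixes p q r s :: complex
  assumes "cmod p = 1" "cmod q = 1" "cmod r = 1" "cmod s = 1" and sum: "p + q + r + s = 0"
  shows "q = - p \<or> r = - p \<or> s = - p"
proof -
  have inv: "u * cnj u = 1" if "cmod u = 1" for u
    using that by (simp add: complex_norm_square[symmetric])
  have u: "p * cnj p = 1" "q * cnj q = 1" "r * cnj r = 1" "s * cnj s = 1"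
    using assms(1-4) inv by blast+
  have "cnj (p + q + r + s) = 0" using sum by simp
  then have sum': "cnj p + cnj q + cnj r + cnj s = 0" by simp
  have s: "s = - (p + q + r)" "cnj s = - (cnj p + cnj q + cnj r)"
    using sum sum' by (metis add_eq_0_iff)+
  have "p * q * r = p * q * r * (s * cnj s)" using u by simp
  also have "\<dots> = (p + q + r) * ((p * cnj p) * (q * r) + (q * cnj q) * (p * r) + (r * cnj r) * (p * q))"
    unfolding s by (simp add: algebra_simps)
  finally have "(p + q) * (p + r) * (q + r) = 0"
    using u by (simp add: algebra_simps)
  then show ?thesis using s(1) by (auto simp: add_eq_0_iff2 add_eq_0_iff)
qed

lemma unimodular_eq_1:
  assumes "cmod u = 1" "Re u \<ge> 1" shows "u = 1"
proof -
  have "Re u = 1" using assms abs_Re_le_cmod[of u] by linarith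
  then show ?thesis using assms(1) by (auto simp: complex_eq_iff cmod_def)
qed

lemma unimodular_eq_minus_1:
  assumes "cmod u = 1" "Re u \<le> -1" shows "u = -1"
  using unimodular_eq_1[of "- u"] assms by (simp add: minus_equation_iff)

section \<open>The sign pattern of the three negative rows\<close>

text \<open>
  In the normalised matrix with indices \<open>0, \<dots>, 5\<close>, rows \<open>1, 2, 3\<close> have diagonal entry \<open>-1\<close> and rows
  \<open>0, 4, 5\<close> have diagonal entry \<open>1\<close>. Here \<open>d, e, f\<close> stand for the entries at \<open>(1, 2)\<close>, \<open>(2, 3)\<close> and
  \<open>(3, 1)\<close>, chosen to make the cyclic symmetry visible, \<open>b\<^sub>j\<close> and \<open>c\<^sub>j\<close> for those at \<open>(4, j)\<close> and
  \<open>(5, j)\<close>, and \<open>z\<close> for that at \<open>(5, 4)\<close>. After the unimodularity conditions come the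
  orthogonality of row \<open>0\<close> with rows \<open>1, 2, 3\<close> and with rows \<open>4, 5\<close>, that of rows \<open>4\<close> and \<open>5\<close>, and that
  of rows \<open>1, 2, 3\<close> with each other.
\<close>
definition three_negative_rows ::
  "complex \<Rightarrow> complex \<Rightarrow> complex \<Rightarrow> complex \<Rightarrow>
   complex \<Rightarrow> complex \<Rightarrow> complex \<Rightarrow> complex \<Rightarrow> complex \<Rightarrow> complex \<Rightarrow> bool" where
  "three_negative_rows z d e f b1 b2 b3 c1 c2 c3 \<longleftrightarrow>
     (\<forall>u \<in> {z, d, e, f, b1, b2, b3, c1, c2, c3}. cmod u = 1) \<and>
     cnj d + f + b1 + c1 = 0 \<and> cnj e + d + b2 + c2 = 0 \<and> cnj f + e + b3 + c3 = 0 \<and>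
     2 + cnj z + b1 + b2 + b3 = 0 \<and> 2 + z + c1 + c2 + c3 = 0 \<and>
     1 + 2 * cnj z + b1 * cnj c1 + b2 * cnj c2 + b3 * cnj c3 = 0 \<and>
     1 - 2 * d + cnj f * cnj e + cnj b1 * b2 + cnj c1 * c2 = 0 \<and>
     1 - 2 * e + cnj d * cnj f + cnj b2 * b3 + cnj c2 * c3 = 0 \<and>
     1 - 2 * f + cnj e * cnj d + cnj b3 * b1 + cnj c3 * c1 = 0"

lemma three_negative_rows_rotate:
  "three_negative_rows z d e f b1 b2 b3 c1 c2 c3 \<Longrightarrow> three_negative_rows z e f d b2 b3 b1 c2 c3 c1"
  unfolding three_negative_rows_def by (simp add: ac_simps)

text \<open>
  This is the effect of interchanging the indices \<open>4\<close> and \<open>5\<close>.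
\<close>
lemma three_negative_rows_swap:
  assumes "three_negative_rows z d e f b1 b2 b3 c1 c2 c3"
  shows "three_negative_rows (cnj z) d e f c1 c2 c3 b1 b2 b3"
proof -
  have "1 + 2 * cnj z + b1 * cnj c1 + b2 * cnj c2 + b3 * cnj c3 = 0"
    using assms by (simp add: three_negative_rows_def)
  then have "cnj (1 + 2 * cnj z + b1 * cnj c1 + b2 * cnj c2 + b3 * cnj c3) = 0" by simp
  then have "1 + 2 * z + c1 * cnj b1 + c2 * cnj b2 + c3 * cnj b3 = 0" by (simp add: mult.commute)
  with assms show ?thesis unfolding three_negative_rows_def by (simp add: ac_simps)
qed

text \<open>
  This excludes the pattern in which the two entries among \<open>d, e, f\<close> in row \<open>1\<close> are opposite to each
  other. In that case the sum of the relations for rows \<open>4\<close> and \<open>5\<close> says \<open>Re e - Re z = 2\<close>, which pins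
  down \<open>e = 1\<close> and \<open>z = -1\<close>. Orthogonality of rows \<open>4\<close> and \<open>5\<close> then makes them agree in columns \<open>2\<close> and
  \<open>3\<close>, so that rows \<open>2\<close> and \<open>3\<close> give \<open>d = f = 1\<close>.
\<close>
lemma no_opposite_first_pair:
  assumes "three_negative_rows z d e f b1 b2 b3 c1 c2 c3"
  shows "f \<noteq> - cnj d"
proof
  assume f: "f = - cnj d"
  have u: "cmod z = 1" "cmod d = 1" "cmod e = 1" "cmod b2 = 1" "cmod b3 = 1" "cmod c2 = 1" "cmod c3 = 1"
    and r: "cnj d + f + b1 + c1 = 0" "cnj e + d + b2 + c2 = 0" "cnj f + e + b3 + c3 = 0"
    and s: "2 + cnj z + b1 + b2 + b3 = 0" "2 + z + c1 + c2 + c3 = 0"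
    and s': "1 + 2 * cnj z + b1 * cnj c1 + b2 * cnj c2 + b3 * cnj c3 = 0"
    and u1: "cmod b1 = 1"
    using assms by (auto simp: three_negative_rows_def)
  \<comment> \<open>With \<open>f = - cnj d\<close>, the contributions of \<open>d\<close> cancel in the sum over both rows.\<close>
  have "4 + (z + cnj z) - (e + cnj e) = 0"
    using r s f by (simp add: complex_eq_iff)
  then have "4 + 2 * Re z = 2 * Re e" by (simp add: complex_eq_iff)
  moreover have "- 1 \<le> Re z" "Re e \<le> 1"
    using abs_Re_le_cmod[of z] abs_Re_le_cmod[of e] u by auto
  ultimately have ze: "z = - 1" "e = 1"
    using u by (auto intro: unimodular_eq_1 unimodular_eq_minus_1)
  have "c1 = - b1" using r(1) f by (simp add: add_eq_0_iff2)
  then have "b1 * cnj c1 = - 1" using u1 by (simp add: complex_norm_square[symmetric])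
  then have "b2 * cnj c2 + b3 * cnj c3 = 2" using s' ze by (simp add: algebra_simps)
  moreover have n: "cmod (b2 * cnj c2) = 1" "cmod (b3 * cnj c3) = 1" using u by (simp_all add: norm_mult)
  ultimately have "Re (b2 * cnj c2) + Re (b3 * cnj c3) = 2"
    by (metis plus_complex.simps(1) complex_Re_numeral)
  moreover have "Re (b2 * cnj c2) \<le> 1" "Re (b3 * cnj c3) \<le> 1"
    using abs_Re_le_cmod[of "b2 * cnj c2"] abs_Re_le_cmod[of "b3 * cnj c3"] n by linarith+
  ultimately have "b2 * cnj c2 = 1" "b3 * cnj c3 = 1"
    using n by (auto intro!: unimodular_eq_1 simp del: times_complex.simps)
  then have "b2 * (c2 * cnj c2) = c2" "b3 * (c3 * cnj c3) = c3" by (simp_all add: mult.left_commute)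
  then have bc: "b2 = c2" "b3 = c3" using u by (simp_all add: complex_norm_square[symmetric])
  \<comment> \<open>Here \<open>1 + w\<close> has modulus \<open>2\<close>.\<close>
  have one: "w = 1" if "1 + w + v + v = 0" "cmod w = 1" "cmod v = 1" for v w
  proof -
    have "1 + w = - (2 * v)" using that(1) by (metis add.assoc eq_neg_iff_add_eq_0 mult_2)
    then have "(cmod (1 + w))\<^sup>2 = 4" using that(3) by (simp add: norm_mult)
    moreover have "(Re w)\<^sup>2 + (Im w)\<^sup>2 = 1" using that(2) by (metis cmod_power2 one_power2)
    moreover have "(cmod (1 + w))\<^sup>2 = (1 + Re w)\<^sup>2 + (Im w)\<^sup>2" by (simp add: cmod_power2)
    ultimately have "Re w = 1" by (simp add: power2_eq_square algebra_simps)
    then show ?thesis using that(2) by (intro unimodular_eq_1) auto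
  qed
  have "d = 1" using r(2) ze bc u by (intro one[of d b2]) auto
  moreover have "cnj f = 1" using r(3) ze bc u f by (intro one[of "cnj f" b3]) (auto simp: add_ac)
  ultimately show False using f by simp
qed

text \<open>
  In each row, the entries from rows \<open>4\<close> and \<open>5\<close> are now opposite to the two entries among
  \<open>d, e, f\<close>, in one of two orders. Suppose rows \<open>1\<close> and \<open>2\<close> use one order and row \<open>3\<close> the other. The
  row sums give \<open>Re e = Re f\<close>, so \<open>f\<close> is \<open>e\<close> or its conjugate. The conjugate makes the two orders in row
  \<open>3\<close> coincide, which is the conclusion; this coincidence really occurs, for \<open>d = 1\<close> and \<open>e = \<i>\<close>.
  The case \<open>f = e\<close> is possible only for real \<open>e\<close>, where both cases agree.
\<close>
lemma mixed_orientation: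
  assumes sys: "three_negative_rows z d e f b1 b2 b3 c1 c2 c3"
    and b: "b1 = - cnj d" "c1 = - f" "b2 = - cnj e" "c2 = - d" "b3 = - e" "c3 = - cnj f"
  shows "b3 = - cnj f" "c3 = - e"
proof -
  have n: "cmod z = 1" "cmod d = 1" "cmod e = 1" "cmod f = 1"
    using sys by (auto simp: three_negative_rows_def)
  have s: "2 + cnj z - cnj d - cnj e - e = 0" "2 + z - f - d - cnj f = 0"
    and s': "1 + 2 * cnj z + cnj d * cnj f + cnj e * cnj d + e * f = 0"
    and o: "1 - 2 * d + cnj f * cnj e + d * cnj e + cnj f * d = 0"
      "1 - 2 * f + cnj e * cnj d + cnj e * cnj d + f * f = 0"
    using sys by (auto simp: three_negative_rows_def b algebra_simps)
  have q: "(Re z)\<^sup>2 + (Im z)\<^sup>2 = 1" "(Re d)\<^sup>2 + (Im d)\<^sup>2 = 1" "(Re e)\<^sup>2 + (Im e)\<^sup>2 = 1" "(Re f)\<^sup>2 + (Im f)\<^sup>2 = 1"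
    using n by (metis cmod_power2 one_power2)+
  have im: "Im z = Im d" and re: "2 + Re z - Re d = 2 * Re e" "2 + Re z - Re d = 2 * Re f"
    using s by (auto simp: complex_eq_iff)
  have ef: "f = e \<or> f = cnj e"
  proof -
    have "(Im e)\<^sup>2 = (Im f)\<^sup>2" using q re by (simp add: algebra_simps)
    then show ?thesis using re by (auto simp: complex_eq_iff power2_eq_iff)
  qed
  have "(Re z)\<^sup>2 = (Re d)\<^sup>2" using q im by simp
  then consider "Re z = Re d" | "Re z = - Re d" by (auto simp: power2_eq_iff)
  then have "f = cnj e"
  proof cases
    case 1
    then have "e = 1" "f = 1" using re n by (auto intro!: unimodular_eq_1)
    then show ?thesis by simp
  next
    case 2
    then have a: "Re e = 1 - Re d" using re by simp
    show ?thesis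
    proof (rule ccontr)
      assume "f \<noteq> cnj e"
      then have f: "f = e" and im0: "Im e \<noteq> 0" using ef by (auto simp: complex_eq_iff)
      have o': "1 - 2 * cnj f + e * d + e * d + cnj f * cnj f = 0"
        using arg_cong[OF o(2), of cnj] by simp
      \<comment> \<open>The difference of the two relations is linear in \<open>d\<close>, and \<open>e - cnj e\<close> is imaginary.\<close>
      have "d * (1 + (e - cnj e)) - cnj e
          = ((1 - 2 * cnj f + e * d + e * d + cnj f * cnj f)
             - (1 - 2 * d + cnj f * cnj e + d * cnj e + cnj f * d)) / 2"
        unfolding f by (simp add: field_simps)
      then have "d * (1 + (e - cnj e)) = cnj e" using o(1) o' by simp
      then have "cmod d * cmod (1 + (e - cnj e)) = cmod (cnj e)" by (metis norm_mult)
      then have "(cmod (1 + (e - cnj e)))\<^sup>2 = 1" using n by simp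
      with im0 show False by (simp add: cmod_power2)
    qed
  qed
  then show "b3 = - cnj f" "c3 = - e" using b by simp_all
qed

text \<open>
  The rotation and the interchange of \<open>4\<close> and \<open>5\<close> reduce every choice of orders to one where rows \<open>1\<close>
  and \<open>2\<close> agree.
\<close>
lemma cyclic_pattern:
  assumes sys: "three_negative_rows z d e f b1 b2 b3 c1 c2 c3"
  shows "(b1 = - cnj d \<and> b2 = - cnj e \<and> b3 = - cnj f \<and> c1 = - f \<and> c2 = - d \<and> c3 = - e) \<or>
         (c1 = - cnj d \<and> c2 = - cnj e \<and> c3 = - cnj f \<and> b1 = - f \<and> b2 = - d \<and> b3 = - e)"
proof -
  define P where "P d f b c \<longleftrightarrow> b = - cnj d \<and> c = - f" for d f b c :: complex
  have pair: "P d f b1 c1 \<or> P d f c1 b1" if "three_negative_rows z d e f b1 b2 b3 c1 c2 c3"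
    for z d e f b1 b2 b3 c1 c2 c3
  proof -
    have "f \<noteq> - cnj d" using no_opposite_first_pair[OF that] .
    moreover have "f = - cnj d \<or> b1 = - cnj d \<or> c1 = - cnj d"
      using that by (intro four_units_sum_zero) (auto simp: three_negative_rows_def)
    moreover have "cnj d + f + b1 + c1 = 0" using that by (simp add: three_negative_rows_def)
    ultimately show ?thesis by (auto simp: P_def add_eq_0_iff2 add_eq_0_iff)
  qed
  have mixed: "P f e b3 c3" if "three_negative_rows z d e f b1 b2 b3 c1 c2 c3"
    "P d f b1 c1" "P e d b2 c2" for z d e f b1 b2 b3 c1 c2 c3
    using pair[OF three_negative_rows_rotate[OF three_negative_rows_rotate[OF that(1)]]]
      mixed_orientation[OF that(1)] that(2,3) unfolding P_def by blast
  note rot = three_negative_rows_rotate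
  note sys2 = rot[OF sys] and sys3 = rot[OF rot[OF sys]]
  note sw = three_negative_rows_swap
  have "P d f b1 c1 \<and> P e d b2 c2 \<and> P f e b3 c3 \<or> P d f c1 b1 \<and> P e d c2 b2 \<and> P f e c3 b3"
    using pair[OF sys] pair[OF sys2] pair[OF sys3]
      mixed[OF sys] mixed[OF sys2] mixed[OF sys3]
      mixed[OF sw[OF sys]] mixed[OF sw[OF sys2]] mixed[OF sw[OF sys3]] by blast
  then show ?thesis by (auto simp: P_def)
qed

section \<open>Solving for the cyclic pattern\<close>

text \<open>
  The hypotheses are the orthogonality relations of the cyclic pattern with \<open>x, t, y\<close> for
  \<open>cnj d, e, - cnj f\<close>. The combination \<open>y e1 + e2\<close> eliminates the mixed term and gives the proportionality of
  \<open>x\<close> and \<open>t\<close>, hence the common value \<open>U\<close>. In terms of \<open>U\<close>, the relation \<open>e1\<close>, times \<open>1 + s\<^sup>2\<close>, is the quadratic equation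
  \<open>U\<^sup>2 - 2 (1 + c) U + (1 + s\<^sup>2) = 0\<close>. Since \<open>|U|\<^sup>2 = 1 + s\<^sup>2\<close>, dividing by \<open>U\<close> leaves
  \<open>U + cnj U = 2 (1 + c)\<close>, so the real part of \<open>U\<close> is known and the imaginary part is known up to sign.
\<close>
lemma cyclic_solution:
  assumes n: "cmod x = 1" "cmod y = 1" "cmod t = 1"
    and e1: "x * t - (2 + y) * t - x * y + 1 = 0"
    and e2: "x * (1 + 2 * y) + t - y - x * y * t = 0"
    and s5: "2 + cnj z - x - cnj t + y = 0"
  defines "c \<equiv> Re y" and "s \<equiv> Im y"
  defines "U \<equiv> x * (1 - \<i> * s)"
  shows "t * (1 + \<i> * s) = U" "Re U = 1 + c" "(Im U)\<^sup>2 = 1 - 2 * c - 2 * c\<^sup>2"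
    "z * (y * (1 + \<i> * s)) = 1 - \<i> * s"
proof -
  have yy: "y * cnj y = 1" using n(2) by (simp add: complex_norm_square[symmetric])
  have y0: "y \<noteq> 0" using n(2) by auto
  have cs: "c\<^sup>2 + s\<^sup>2 = 1" unfolding c_def s_def using n(2) by (metis cmod_power2 one_power2)
  have y: "y = c + \<i> * s" and ybar: "cnj y = c - \<i> * s"
    by (simp_all add: c_def s_def complex_eq_iff)
  have N: "(1 - \<i> * s) * (1 + \<i> * s) = complex_of_real (1 + s\<^sup>2)"
    by (simp add: algebra_simps power2_eq_square complex_eq_iff)
  have pm: "2 * y * (1 + \<i> * s) = 2 * y + y\<^sup>2 - 1" "2 * y * (1 - \<i> * s) = 2 * y - y\<^sup>2 + 1"
  proof -
    have si: "2 * \<i> * s = y - cnj y" unfolding y ybar by simp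
    have "2 * y * (1 + \<i> * s) = 2 * y + y * (2 * \<i> * s)" by (simp add: algebra_simps)
    then show "2 * y * (1 + \<i> * s) = 2 * y + y\<^sup>2 - 1"
      unfolding si using yy by (simp add: algebra_simps power2_eq_square)
    have "2 * y * (1 - \<i> * s) = 2 * y - y * (2 * \<i> * s)" by (simp add: algebra_simps)
    then show "2 * y * (1 - \<i> * s) = 2 * y - y\<^sup>2 + 1"
      unfolding si using yy by (simp add: algebra_simps power2_eq_square)
  qed
  have "2 * y * (t * (1 + \<i> * s) - x * (1 - \<i> * s))
      = t * (2 * y * (1 + \<i> * s)) - x * (2 * y * (1 - \<i> * s))"
    by (simp add: algebra_simps)
  also have "\<dots> = - (y * (x * t - (2 + y) * t - x * y + 1) + (x * (1 + 2 * y) + t - y - x * y * t))"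
    unfolding pm by (simp add: algebra_simps power2_eq_square)
  finally show tU: "t * (1 + \<i> * s) = U" using y0 e1 e2 by (simp add: U_def)
  have "U * cnj U = (x * cnj x) * ((1 - \<i> * s) * (1 + \<i> * s))" by (simp add: U_def)
  then have UU: "U * cnj U = complex_of_real (1 + s\<^sup>2)"
    using n(1) N by (simp add: complex_norm_square[symmetric])
  have "U * U - 2 * (1 + c) * U + U * cnj U
      = (x * (1 - \<i> * s)) * (t * (1 + \<i> * s)) - (2 + y) * (1 - \<i> * s) * (t * (1 + \<i> * s))
        - y * (1 + \<i> * s) * (x * (1 - \<i> * s)) + (1 - \<i> * s) * (1 + \<i> * s)"
    unfolding tU U_def[symmetric] UU N by (simp add: y algebra_simps)
  also have "\<dots> = ((1 - \<i> * s) * (1 + \<i> * s)) * (x * t - (2 + y) * t - x * y + 1)"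
    by (simp add: algebra_simps)
  finally have "U * U - 2 * (1 + c) * U + U * cnj U = 0" unfolding e1 by simp
  then have "U * (U + cnj U - 2 * (1 + c)) = 0" by (simp add: algebra_simps)
  moreover have "U \<noteq> 0"
  proof
    assume "U = 0"
    then have "complex_of_real (1 + s\<^sup>2) = 0" using UU by simp
    then have "1 + s\<^sup>2 = 0" by (simp only: of_real_eq_0_iff)
    then show False using zero_le_power2[of s] by linarith
  qed
  ultimately have UU2: "U + cnj U = 2 * (1 + c)" by simp
  then show re: "Re U = 1 + c" by (simp add: complex_eq_iff)
  have "complex_of_real ((cmod U)\<^sup>2) = of_real (1 + s\<^sup>2)" using UU by (simp only: complex_norm_square)
  then have "(cmod U)\<^sup>2 = 1 + s\<^sup>2" by (simp only: of_real_eq_iff)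
  then show "(Im U)\<^sup>2 = 1 - 2 * c - 2 * c\<^sup>2"
    using cs by (simp add: cmod_power2 re) (simp add: power2_eq_square algebra_simps)
  have "cnj (2 + cnj z - x - cnj t + y) = 0" using s5 by simp
  then have s6: "z = cnj x + t - cnj y - 2" by (simp add: algebra_simps)
  have "z * (1 + \<i> * s) = cnj U + t * (1 + \<i> * s) - (cnj y + 2) * (1 + \<i> * s)"
    unfolding s6 U_def by (simp add: algebra_simps)
  then have zs: "z * (1 + \<i> * s) = 2 * (1 + c) - (cnj y + 2) * (1 + \<i> * s)"
    using UU2 unfolding tU by (simp add: add.commute)
  have "z * (y * (1 + \<i> * s)) = y * (z * (1 + \<i> * s))" by (simp only: mult_ac)
  also have "\<dots> = 2 * (1 + c) * y - (y * cnj y + 2 * y) * (1 + \<i> * s)"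
    unfolding zs by (simp add: algebra_simps)
  also have "\<dots> = 2 * (y * cnj y) - y * cnj y - y * cnj y * (\<i> * s)"
    unfolding ybar by (simp add: algebra_simps)
  finally show "z * (y * (1 + \<i> * s)) = 1 - \<i> * s" using yy by simp
qed

section \<open>Symmetries of the cyclic pattern and the family\<close>

text \<open>
  The shape of the family, with \<open>x, y, z, t\<close> independent of each other.
\<close>
definition cyclic_matrix :: "complex \<Rightarrow> complex \<Rightarrow> complex \<Rightarrow> complex \<Rightarrow> complex mat" where
  "cyclic_matrix x y z t = mat_of_rows_list 6
       [[1,       1,       1,       1,       1,       1],
        [1,     - 1,   cnj x,     - y, - cnj x,       y],
        [1,       x,     - 1,       t,     - t,     - x],
        [1, - cnj y,   cnj t,     - 1,   cnj y, - cnj t],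
        [1,     - x, - cnj t,       y,       1,   cnj z],
        [1,   cnj y, - cnj x,     - t,       z,       1]]"

lemma less_6_cases: "i < 6 \<longleftrightarrow> i = 0 \<or> i = 1 \<or> i = 2 \<or> i = 3 \<or> i = 4 \<or> i = (5::nat)"
  by auto

lemma cyclic_matrix_carrier: "cyclic_matrix x y z t \<in> carrier_mat 6 6"
  by (rule carrier_matI) (simp_all add: cyclic_matrix_def mat_of_rows_list_def)

lemma monomially_equiv_conjugate_perm:
  assumes "\<sigma> permutes {..<n}"
  shows "monomially_equiv n A (mat n n (\<lambda>(i, j). A $$ (\<sigma> i, \<sigma> j)))"
  unfolding monomially_equiv_def using assms
  by (intro exI[of _ \<sigma>] exI[of _ "\<lambda>_. 1"]) auto

text \<open>
  Interchanging the indices \<open>1, 3\<close> and \<open>4, 5\<close> preserves the shape: the former reverses the cyclic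
  order of rows \<open>1, 2, 3\<close>, and the latter compensates for it.
\<close>
lemma cyclic_matrix_reflect: "monomially_equiv 6 (cyclic_matrix x y z t) (cyclic_matrix t (cnj y) (cnj z) x)"
proof -
  define \<sigma> where "\<sigma> = transpose 1 3 \<circ> transpose 4 (5::nat)"
  have "\<sigma> permutes {..<6}"
    unfolding \<sigma>_def by (intro permutes_compose permutes_swap_id) auto
  moreover have "cyclic_matrix t (cnj y) (cnj z) x = mat 6 6 (\<lambda>(i, j). cyclic_matrix x y z t $$ (\<sigma> i, \<sigma> j))"
    by (rule eq_matI) (auto simp: cyclic_matrix_def mat_of_rows_list_def less_6_cases \<sigma>_def transpose_def)
  ultimately show ?thesis using monomially_equiv_conjugate_perm by metis
qed

lemma cyclic_matrix_rotate: "monomially_equiv 6 (cyclic_matrix x y z t) (cyclic_matrix (cnj t) (- x) z (- cnj y))"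
proof -
  define \<sigma> where "\<sigma> = transpose 1 2 \<circ> transpose 2 (3::nat)"
  have "\<sigma> permutes {..<6}"
    unfolding \<sigma>_def by (intro permutes_compose permutes_swap_id) auto
  moreover have "cyclic_matrix (cnj t) (- x) z (- cnj y) = mat 6 6 (\<lambda>(i, j). cyclic_matrix x y z t $$ (\<sigma> i, \<sigma> j))"
    by (rule eq_matI) (auto simp: cyclic_matrix_def mat_of_rows_list_def less_6_cases \<sigma>_def transpose_def)
  ultimately show ?thesis using monomially_equiv_conjugate_perm by metis
qed

text \<open>
  With \<open>y = c + \<i>s\<close> and \<open>R = Im U\<close>, the radicand in the family equals \<open>-2 y\<^sup>2 R\<^sup>2\<close>, whose square roots are
  \<open>\<plusminus> \<surd>2 \<i> y R\<close>. The root \<open>w = - \<surd>2 \<i> y R\<close> turns the numerator of \<open>x\<close> and \<open>t\<close> into \<open>2 y U\<close>. The last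
  hypothesis states that \<open>w\<close>, which has real part \<open>\<surd>2 s R\<close> and imaginary part \<open>- \<surd>2 c R\<close>, is the
  principal root.
\<close>
lemma H_family_eqI:
  assumes y: "y = exp (\<i> * complex_of_real \<theta>)"
    and U: "x * (1 - \<i> * Im y) = U" "t * (1 + \<i> * Im y) = U"
      "Re U = 1 + Re y" "(Im U)\<^sup>2 = 1 - 2 * Re y - 2 * (Re y)\<^sup>2"
    and z: "z * (y * (1 + \<i> * Im y)) = 1 - \<i> * Im y"
    and sgn: "0 < Im y * Im U \<or> Im y * Im U = 0 \<and> Re y * Im U \<le> 0"
  shows "H_family \<theta> = cyclic_matrix x y z t"
proof -
  define c s R where "c = Re y" and "s = Im y" and "R = Im U"
  have n: "cmod y = 1" unfolding y by simp
  then have y0: "y \<noteq> 0" by auto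
  have cs: "c\<^sup>2 + s\<^sup>2 = 1" unfolding c_def s_def using n by (metis cmod_power2 one_power2)
  then have cs': "complex_of_real c ^ 2 + complex_of_real s ^ 2 = 1"
    by (metis of_real_1 of_real_add of_real_power)
  have ycs: "y = c + \<i> * s" and Uc: "U = 1 + c + \<i> * R"
    by (simp_all add: c_def s_def R_def complex_eq_iff U)
  have nz: "1 + \<i> * s \<noteq> 0" "1 - \<i> * s \<noteq> 0" by (simp_all add: complex_eq_iff)
  have y2: "y\<^sup>2 = 2 * c * y - 1"
    unfolding cs'[symmetric] unfolding ycs by (simp add: power2_eq_square algebra_simps)
  have ys: "2 * \<i> * s * y = y\<^sup>2 - 1"
    unfolding cs'[symmetric] unfolding ycs by (simp add: power2_eq_square algebra_simps)
  have d1: "1 + 2 * y - y\<^sup>2 = 2 * y * (1 - \<i> * s)" and d2: "- 1 + 2 * y + y\<^sup>2 = 2 * y * (1 + \<i> * s)"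
    using ys by (simp_all add: algebra_simps)
  have R2: "complex_of_real R ^ 2 = 1 - 2 * c - 2 * c\<^sup>2"
    using U(4) unfolding c_def R_def by (metis of_real_power)
  define w where "w = - \<i> * y * complex_of_real (sqrt 2) * R"
  have "1 + 2 * y + 2 * y ^ 3 + y ^ 4 = - 2 * y\<^sup>2 * (1 - 2 * c - 2 * c\<^sup>2)"
  proof -
    have "y ^ 3 = y * y\<^sup>2" "y ^ 4 = y\<^sup>2 * y\<^sup>2" by (simp_all add: eval_nat_numeral)
    then have "1 + 2 * y + 2 * y ^ 3 + y ^ 4 = 1 + 2 * y + 2 * (y * y\<^sup>2) + y\<^sup>2 * y\<^sup>2" by simp
    also have "2 * (y * y\<^sup>2) + 2 * y = 4 * c * y\<^sup>2"
    proof -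
      have "2 * (y * y\<^sup>2) + 2 * y = 2 * y * (y\<^sup>2 + 1)" by (simp add: algebra_simps)
      also have "\<dots> = 2 * y * (2 * c * y)" unfolding y2 by simp
      finally show ?thesis by (simp add: power2_eq_square algebra_simps)
    qed
    then have "1 + 2 * y + 2 * (y * y\<^sup>2) + y\<^sup>2 * y\<^sup>2 = 4 * c * y\<^sup>2 + (1 + y\<^sup>2 * y\<^sup>2)" by (simp add: algebra_simps)
    also have "1 + y\<^sup>2 * y\<^sup>2 = (1 + y\<^sup>2) * (1 + y\<^sup>2) - 2 * y\<^sup>2" by (simp add: algebra_simps)
    also have "1 + y\<^sup>2 = 2 * c * y" unfolding y2 by simp
    finally show ?thesis by (simp add: power2_eq_square algebra_simps)
  qed
  moreover have "w\<^sup>2 = - 2 * y\<^sup>2 * (1 - 2 * c - 2 * c\<^sup>2)"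
  proof -
    have "complex_of_real (sqrt 2) ^ 2 = 2" by (simp flip: of_real_power)
    then show ?thesis by (simp add: w_def power_mult_distrib R2)
  qed
  ultimately have w2: "w\<^sup>2 = 1 + 2 * y + 2 * y ^ 3 + y ^ 4" by simp
  have "Re w = sqrt 2 * (s * R)" "Im w = - sqrt 2 * (c * R)"
    by (simp_all add: w_def c_def s_def)
  then have "csqrt (1 + 2 * y + 2 * y ^ 3 + y ^ 4) = w"
    using sgn by (intro csqrt_unique w2) (auto simp: c_def s_def R_def mult_le_0_iff)
  moreover have "1 + 2 * y + y\<^sup>2 - complex_of_real (sqrt 2) * w = 2 * y * U"
  proof -
    have "complex_of_real (sqrt 2) * w = - (complex_of_real (sqrt 2) * complex_of_real (sqrt 2)) * \<i> * y * R"
      by (simp add: w_def)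
    also have "\<dots> = - 2 * \<i> * y * R" by (simp flip: of_real_mult)
    finally show ?thesis unfolding Uc y2 by (simp add: algebra_simps)
  qed
  ultimately have num: "1 + 2 * y + y\<^sup>2 - complex_of_real (sqrt 2) * csqrt (1 + 2 * y + 2 * y ^ 3 + y ^ 4) = 2 * y * U"
    by simp
  have py: "par_y \<theta> = y" by (simp add: par_y_def y)
  have "x = U / (1 - \<i> * s)" "t = U / (1 + \<i> * s)" "z = (1 - \<i> * s) / (y * (1 + \<i> * s))"
    using y0 nz U(1,2) z unfolding s_def by (simp_all add: eq_divide_eq)
  then have "par_x \<theta> = x" "par_t \<theta> = t" "par_z \<theta> = z"
    unfolding par_x_def par_t_def par_z_def Let_def py num d1 d2
    using y0 by simp_all
  then show ?thesis by (simp add: H_family_def cyclic_matrix_def py Let_def)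
qed

text \<open>
  The number \<open>(-1 + \<surd>3)/2\<close> is the positive root of \<open>1 - 2 m - 2 m\<^sup>2\<close>, so \<open>cos \<theta>\<close> is at most this root.
\<close>
lemma theta_range:
  assumes y: "exp (\<i> * complex_of_real \<theta>) = y" "\<bar>\<theta>\<bar> \<le> pi" and c: "0 \<le> 1 - 2 * Re y - 2 * (Re y)\<^sup>2"
  shows "\<theta> \<in> {- pi .. - arccos ((- 1 + sqrt 3) / 2)} \<union> {arccos ((- 1 + sqrt 3) / 2) .. pi}"
proof -
  define m where "m = (- 1 + sqrt 3) / 2"
  have cos: "cos \<bar>\<theta>\<bar> = Re y" using y(1) by (auto simp: Re_exp)
  have m: "1 - 2 * m - 2 * m\<^sup>2 = 0" "0 < m" "m \<le> 1"
    using sqrt_le_D[of 3 2] real_le_lsqrt[of 3 3] by (auto simp: m_def power2_eq_square field_simps)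
  have "Re y \<le> m"
  proof (rule ccontr)
    assume "\<not> Re y \<le> m"
    then have "m < Re y" by simp
    moreover from this have "m\<^sup>2 < (Re y)\<^sup>2" using m by (intro power_strict_mono) auto
    ultimately show False using c m by linarith
  qed
  moreover have "- 1 \<le> Re y" unfolding cos[symmetric] by simp
  ultimately have "arccos m \<le> arccos (Re y)" using m by (intro arccos_le_arccos) auto
  also have "arccos (Re y) = \<bar>\<theta>\<bar>" unfolding cos[symmetric] using y(2) by (intro arccos_cos) auto
  finally show ?thesis using y(2) unfolding m_def by auto
qed

text \<open>
  If \<open>U\<close> has the sign selected by the principal root, the matrix lies in the family. Otherwise the
  reflection changes the sign of \<open>Im y\<close> and keeps \<open>U\<close>. It does not help when \<open>Im y = 0\<close>, and then
  \<open>y = -1\<close>, \<open>U = -\<i>\<close>: this single matrix is carried to \<open>\<theta> = \<pi>/2\<close> by a rotation.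
\<close>
lemma cyclic_matrix_equiv_H_family:
  assumes ny: "cmod y = 1"
    and U: "x * (1 - \<i> * Im y) = U" "t * (1 + \<i> * Im y) = U"
      "Re U = 1 + Re y" "(Im U)\<^sup>2 = 1 - 2 * Re y - 2 * (Re y)\<^sup>2"
    and z: "z * (y * (1 + \<i> * Im y)) = 1 - \<i> * Im y"
  shows "\<exists>\<theta> \<in> {- pi .. - arccos ((- 1 + sqrt 3) / 2)} \<union> {arccos ((- 1 + sqrt 3) / 2) .. pi}.
           monomially_equiv 6 (cyclic_matrix x y z t) (H_family \<theta>)"
proof -
  have self: "monomially_equiv 6 A A" if "A \<in> carrier_mat 6 6" for A
  proof -
    have "A = mat 6 6 (\<lambda>(i, j). A $$ (i, j))" using that by auto
    then show ?thesis using monomially_equiv_conjugate_perm[OF permutes_id, of 6 A] by simp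
  qed
  have c0: "0 \<le> 1 - 2 * Re y - 2 * (Re y)\<^sup>2" using U(4) by (metis zero_le_power2)
  define \<theta> where "\<theta> = Arg y"
  have "y \<noteq> 0" using ny by auto
  then have th: "exp (\<i> * complex_of_real \<theta>) = y" "\<bar>\<theta>\<bar> \<le> pi"
    using ny cis_Arg[of y] Arg_bounded[of y] by (auto simp: \<theta>_def sgn_eq simp flip: cis_conv_exp)
  have n: "(Re y)\<^sup>2 + (Im y)\<^sup>2 = 1" using ny by (metis cmod_power2 one_power2)
  consider "0 < Im y * Im U \<or> Im y * Im U = 0 \<and> Re y * Im U \<le> 0" | "Im y * Im U < 0"
    | "Im y * Im U = 0" "Re y * Im U > 0" by linarith
  then show ?thesis
  proof cases
    case 1
    show ?thesis using H_family_eqI[OF th(1)[symmetric] U z 1] theta_range[OF th c0]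
        self[OF cyclic_matrix_carrier] by metis
  next
    case 2
    have "exp (\<i> * complex_of_real (- \<theta>)) = cnj (cis \<theta>)"
      unfolding cis_cnj by (rule cis_conv_exp[symmetric])
    then have th': "exp (\<i> * complex_of_real (- \<theta>)) = cnj y" "\<bar>- \<theta>\<bar> \<le> pi"
      using th by (simp_all add: cis_conv_exp)
    have c0': "0 \<le> 1 - 2 * Re (cnj y) - 2 * (Re (cnj y))\<^sup>2" using c0 by simp
    have z': "cnj z * (cnj y * (1 + \<i> * Im (cnj y))) = 1 - \<i> * Im (cnj y)"
      using arg_cong[OF z, of cnj] by simp
    have "H_family (- \<theta>) = cyclic_matrix t (cnj y) (cnj z) x"
      by (rule H_family_eqI[OF th'(1)[symmetric] _ _ _ _ z', of _ U]) (use U 2 in auto)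
    then show ?thesis using theta_range[OF th' c0'] cyclic_matrix_reflect by metis
  next
    case 3
    have s: "Im y = 0" using 3 by auto
    then have "Re y = 1 \<or> Re y = - 1" using n by (auto simp: power2_eq_1_iff)
    then have y: "Re y = - 1" using c0 by auto
    then have yy: "y = - 1" using s by (simp add: complex_eq_iff)
    have "Im U = - 1" using 3 U(4) y by (auto simp: power2_eq_1_iff)
    then have "U = - \<i>" using U(3) y by (simp add: complex_eq_iff)
    then have xt: "x = - \<i>" "t = - \<i>" "z = - 1" using U(1,2) z s yy by (auto simp: minus_equation_iff)
    have ei: "exp (\<i> * complex_of_real (pi / 2)) = \<i>" using cis_conv_exp[of "pi / 2"] by simp
    have "H_family (pi / 2) = cyclic_matrix \<i> \<i> (- 1) 1"
      by (rule H_family_eqI[of _ _ _ "1 + \<i>"]) (use ei in \<open>auto simp: algebra_simps\<close>)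
    moreover have "pi / 2 \<in> {- pi .. - arccos ((- 1 + sqrt 3) / 2)} \<union> {arccos ((- 1 + sqrt 3) / 2) .. pi}"
      by (rule theta_range[OF ei]) auto
    moreover have "monomially_equiv 6 (cyclic_matrix x y z t) (cyclic_matrix \<i> \<i> (- 1) 1)"
      using cyclic_matrix_rotate[of x y z t] by (simp add: xt yy)
    ultimately show ?thesis by metis
  qed
qed

section \<open>Reduction to the normal form\<close>

text \<open>
  Of the two coherent patterns left by \<open>cyclic_pattern\<close>, one is the shape of the family and the
  other becomes it on interchanging the indices \<open>4\<close> and \<open>5\<close>.
\<close>
lemma normalised_hadamard_equiv_H_family:
  assumes had: "complex_hadamard 6 K"
    and adj: "\<And>i j. i < 6 \<Longrightarrow> j < 6 \<Longrightarrow> K $$ (j, i) = cnj (K $$ (i, j))"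
    and row: "\<And>j. j < 6 \<Longrightarrow> K $$ (0, j) = 1"
    and diag: "\<And>i. i < 6 \<Longrightarrow> K $$ (i, i) = (if i \<in> {1, 2, 3} then - 1 else 1)"
  shows "\<exists>\<theta> \<in> {- pi .. - arccos ((- 1 + sqrt 3) / 2)} \<union> {arccos ((- 1 + sqrt 3) / 2) .. pi}.
           monomially_equiv 6 K (H_family \<theta>)"
proof -
  have K: "K \<in> carrier_mat 6 6" and unit: "\<And>i j. i < 6 \<Longrightarrow> j < 6 \<Longrightarrow> cmod (K $$ (i, j)) = 1"
    and orth: "\<And>i j. i < 6 \<Longrightarrow> j < 6 \<Longrightarrow> i \<noteq> j \<Longrightarrow> (\<Sum>k = 0..<6. K $$ (i, k) * cnj (K $$ (j, k))) = 0"
    using had by (auto simp: complex_hadamard_iff)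
  define z d e f where "z = K $$ (5, 4)" and "d = K $$ (1, 2)" and "e = K $$ (2, 3)" and "f = K $$ (3, 1)"
  define b where "b j = K $$ (4, j)" for j
  define c where "c j = K $$ (5, j)" for j
  note defs = z_def d_def e_def f_def b_def c_def
  have entries: "K $$ (1, 2) = d" "K $$ (2, 3) = e" "K $$ (3, 1) = f" "K $$ (2, 1) = cnj d" "K $$ (3, 2) = cnj e"
    "K $$ (1, 3) = cnj f" "K $$ (5, 4) = z" "K $$ (4, 5) = cnj z"
    "K $$ (4, 1) = b 1" "K $$ (4, 2) = b 2" "K $$ (4, 3) = b 3"
    "K $$ (1, 4) = cnj (b 1)" "K $$ (2, 4) = cnj (b 2)" "K $$ (3, 4) = cnj (b 3)"
    "K $$ (5, 1) = c 1" "K $$ (5, 2) = c 2" "K $$ (5, 3) = c 3"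
    "K $$ (1, 5) = cnj (c 1)" "K $$ (2, 5) = cnj (c 2)" "K $$ (3, 5) = cnj (c 3)"
    "K $$ (0, 0) = 1" "K $$ (0, 1) = 1" "K $$ (0, 2) = 1" "K $$ (0, 3) = 1" "K $$ (0, 4) = 1" "K $$ (0, 5) = 1"
    "K $$ (1, 0) = 1" "K $$ (2, 0) = 1" "K $$ (3, 0) = 1" "K $$ (4, 0) = 1" "K $$ (5, 0) = 1"
    "K $$ (1, 1) = - 1" "K $$ (2, 2) = - 1" "K $$ (3, 3) = - 1" "K $$ (4, 4) = 1" "K $$ (5, 5) = 1"
    unfolding defs by (simp_all add: diag row adj[of 0] adj[of 1 2] adj[of 2 3] adj[of 3 1] adj[of 5 4]
        adj[of 4 1] adj[of 4 2] adj[of 4 3] adj[of 5 1] adj[of 5 2] adj[of 5 3] del: One_nat_def)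
  have "{0..<6} = {0, 1, 2, 3, 4, 5::nat}" by auto
  then have S: "sum g {0..<6} = g 0 + g 1 + g 2 + g 3 + g 4 + g 5" for g :: "nat \<Rightarrow> complex"
    by (simp add: add_ac)
  have o: "K $$ (i, 0) * cnj (K $$ (j, 0)) + K $$ (i, 1) * cnj (K $$ (j, 1)) + K $$ (i, 2) * cnj (K $$ (j, 2))
      + K $$ (i, 3) * cnj (K $$ (j, 3)) + K $$ (i, 4) * cnj (K $$ (j, 4)) + K $$ (i, 5) * cnj (K $$ (j, 5)) = 0"
    if "i < 6" "j < 6" "i \<noteq> j" for i j using orth[OF that] unfolding S .
  have sys: "three_negative_rows z d e f (b 1) (b 2) (b 3) (c 1) (c 2) (c 3)"
    unfolding three_negative_rows_def
    using o[of 0 1] o[of 0 2] o[of 0 3] o[of 4 0] o[of 5 0] o[of 4 5] o[of 1 2] o[of 2 3] o[of 3 1]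
      unit unfolding entries by (simp add: defs algebra_simps)
  have goal: "\<exists>\<theta> \<in> {- pi .. - arccos ((- 1 + sqrt 3) / 2)} \<union> {arccos ((- 1 + sqrt 3) / 2) .. pi}.
           monomially_equiv 6 (cyclic_matrix (cnj d) (- cnj f) z e) (H_family \<theta>)"
    if "three_negative_rows z d e f (- cnj d) (- cnj e) (- cnj f) (- f) (- d) (- e)" for z
  proof -
    have u: "cmod (cnj d) = 1" "cmod (- cnj f) = 1" "cmod e = 1"
      using that by (auto simp: three_negative_rows_def)
    have e1: "cnj d * e - (2 + - cnj f) * e - cnj d * - cnj f + 1 = 0"
      and o31: "1 - 2 * f + cnj e * cnj d + f * cnj d + cnj e * f = 0"
      and s5: "2 + cnj z - cnj d - cnj e + - cnj f = 0"
      using that by (simp_all add: three_negative_rows_def algebra_simps)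
    have dd: "d * cnj d = 1" using u by (simp add: complex_norm_square[symmetric])
    \<comment> \<open>Conjugating and multiplying by the unimodular \<open>cnj d\<close> brings the relation to polynomial form.\<close>
    have "cnj (1 - 2 * f + cnj e * cnj d + f * cnj d + cnj e * f) = 0" using o31 by simp
    then have "cnj d * (1 - 2 * cnj f + e * d + cnj f * d + e * cnj f) = 0" by simp
    then have "cnj d * (1 - 2 * cnj f) + e * (d * cnj d) + cnj f * (d * cnj d) + cnj d * e * cnj f = 0"
      by (simp add: algebra_simps)
    then have e2: "cnj d * (1 + 2 * - cnj f) + e - - cnj f - cnj d * - cnj f * e = 0"
      unfolding dd by (simp add: algebra_simps)
    note sol = cyclic_solution[OF u e1 e2 s5]
    show ?thesis by (rule cyclic_matrix_equiv_H_family[OF u(2) refl sol])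
  qed
  from cyclic_pattern[OF sys] show ?thesis
  proof (elim disjE conjE)
    assume p: "b 1 = - cnj d" "b 2 = - cnj e" "b 3 = - cnj f" "c 1 = - f" "c 2 = - d" "c 3 = - e"
    have "K = cyclic_matrix (cnj d) (- cnj f) z e"
      using K by (intro eq_matI)
        (auto simp: cyclic_matrix_def mat_of_rows_list_def less_6_cases entries p simp flip: One_nat_def)
    then show ?thesis using goal[of z] sys unfolding p by simp
  next
    assume p: "c 1 = - cnj d" "c 2 = - cnj e" "c 3 = - cnj f" "b 1 = - f" "b 2 = - d" "b 3 = - e"
    define \<sigma> where "\<sigma> = transpose 4 (5::nat)"
    have "\<sigma> permutes {..<6}" unfolding \<sigma>_def by (intro permutes_swap_id) auto
    moreover have "cyclic_matrix (cnj d) (- cnj f) (cnj z) e = mat 6 6 (\<lambda>(i, j). K $$ (\<sigma> i, \<sigma> j))"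
      by (rule eq_matI) (auto simp: cyclic_matrix_def mat_of_rows_list_def less_6_cases entries p
          \<sigma>_def transpose_def simp flip: One_nat_def)
    ultimately have "monomially_equiv 6 K (cyclic_matrix (cnj d) (- cnj f) (cnj z) e)"
      using monomially_equiv_conjugate_perm by metis
    then show ?thesis using goal[of "cnj z"] three_negative_rows_swap[OF sys] monomially_equiv_trans
      unfolding p by blast
  qed
qed

lemma permutation_between_subsets:
  assumes "finite S" "A \<subseteq> S" "B \<subseteq> S" "card A = card B"
  shows "\<exists>\<sigma>. \<sigma> permutes S \<and> (\<forall>i\<in>S. \<sigma> i \<in> B \<longleftrightarrow> i \<in> A)"
proof -
  have fin: "finite A" "finite B" using assms finite_subset by blast+
  obtain g where g: "bij_betw g A B" using finite_same_card_bij[OF fin assms(4)] by blast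
  have "card (S - A) = card (S - B)" using assms fin by (simp add: card_Diff_subset)
  then obtain h where h: "bij_betw h (S - A) (S - B)"
    using finite_same_card_bij assms(1) finite_Diff by metis
  define \<sigma> where "\<sigma> i = (if i \<in> A then g i else if i \<in> S then h i else i)" for i
  have "bij_betw \<sigma> (A \<union> (S - A)) (B \<union> (S - B))"
  proof (rule bij_betw_combine)
    show "bij_betw \<sigma> A B" using g by (simp add: \<sigma>_def cong: bij_betw_cong)
    show "bij_betw \<sigma> (S - A) (S - B)" using h by (subst bij_betw_cong[where g = h]) (auto simp: \<sigma>_def)
  qed auto
  moreover have "A \<union> (S - A) = S" "B \<union> (S - B) = S" using assms by auto
  ultimately have "\<sigma> permutes S"
    using assms(2) by (intro bij_imp_permutes) (auto simp: \<sigma>_def)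
  moreover have "\<forall>i\<in>S. \<sigma> i \<in> B \<longleftrightarrow> i \<in> A"
    using g h by (auto simp: \<sigma>_def bij_betw_def)
  ultimately show ?thesis by blast
qed

theorem theorem2p1:
  fixes H :: "complex mat"
  assumes "complex_hadamard 6 H"
    and "mat_adjoint H = H"
  shows "\<exists>\<theta> \<in> {- pi .. - arccos ((- 1 + sqrt 3) / 2)} \<union> {arccos ((- 1 + sqrt 3) / 2) .. pi}.
           hadamard_equiv 6 H (H_family \<theta>)"
proof -
  have H: "H \<in> carrier_mat 6 6" and unit: "\<And>i j. i < 6 \<Longrightarrow> j < 6 \<Longrightarrow> cmod (H $$ (i, j)) = 1"
    using assms(1) by (auto simp: complex_hadamard_def)
  have adj: "H $$ (j, i) = cnj (H $$ (i, j))" if "i < 6" "j < 6" for i j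
    using mat_adjoint_index[OF H that(2,1)] assms(2) by simp
  define pos where "pos = {i \<in> {..<6}. H $$ (i, i) = 1}"
  have diag: "H $$ (i, i) = (if i \<in> pos then 1 else - 1)" if "i < 6" for i
  proof -
    have "H $$ (i, i) \<in> \<real>" using adj[OF that that] by (simp add: Reals_cnj_iff)
    then obtain r where r: "H $$ (i, i) = of_real r" by (elim Reals_cases)
    then have "r = 1 \<or> r = - 1" using unit[OF that that] by auto
    then show ?thesis using r that by (auto simp: pos_def)
  qed
  have "\<not> (\<exists>k. (6::nat) = k\<^sup>2)"
  proof
    assume "\<exists>k. (6::nat) = k\<^sup>2"
    then obtain k :: nat where k: "6 = k\<^sup>2" ..
    then have "2\<^sup>2 < k\<^sup>2" "k\<^sup>2 < 3\<^sup>2" by simp_all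
    then have "2 < k" "k < 3" by (simp_all only: power2_less_imp_less power2_nat_le_imp_le)
    then show False by simp
  qed
  then have "0 = (\<Sum>i = 0..<6. H $$ (i, i))" using selfadjoint_hadamard_trace[OF assms] by simp
  also have "\<dots> = (\<Sum>i\<in>{..<6}. if i \<in> pos then 1 else - 1)"
    unfolding lessThan_atLeast0 using diag by (intro sum.cong) auto
  also have "\<dots> = (\<Sum>i\<in>pos. 1) + (\<Sum>i\<in>{..<6} - pos. - 1)"
  proof -
    have "{..<6} \<inter> pos = pos" "{..<6} \<inter> - pos = {..<6} - pos" by (auto simp: pos_def)
    then show ?thesis by (simp add: sum.If_cases)
  qed
  also have "\<dots> = of_nat (card pos) - of_nat (card ({..<6} - pos))"
    by simp
  also have "card ({..<6} - pos) = 6 - card pos"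
    by (subst card_Diff_subset) (auto simp: pos_def)
  finally have "card pos = card {0, 4, 5::nat}"
    using card_mono[of "{..<6}" pos] by (auto simp: pos_def of_nat_diff)
  then obtain \<sigma> where \<sigma>: "\<sigma> permutes {..<6}" "\<forall>i\<in>{..<6}. \<sigma> i \<in> pos \<longleftrightarrow> i \<in> {0, 4, 5}"
    using permutation_between_subsets[of "{..<6}" "{0, 4, 5}" pos] by (auto simp: pos_def)
  have lt: "\<sigma> i < 6" if "i < 6" for i using that permutes_in_image[OF \<sigma>(1), of i] by simp
  \<comment> \<open>A unitary diagonal conjugation keeps the matrix self-adjoint and its diagonal fixed.\<close>
  define K where "K = mat 6 6 (\<lambda>(i, j). H $$ (\<sigma> 0, \<sigma> i) * H $$ (\<sigma> i, \<sigma> j) * cnj (H $$ (\<sigma> 0, \<sigma> j)))"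
  have eq: "monomially_equiv 6 H K"
    unfolding monomially_equiv_def K_def using \<sigma>(1) unit lt
    by (intro exI[of _ \<sigma>] exI[of _ "\<lambda>i. H $$ (\<sigma> 0, \<sigma> i)"] exI[of _ "\<lambda>i. cnj (H $$ (\<sigma> 0, \<sigma> i))"]) auto
  have Hu: "H $$ (i, j) * cnj (H $$ (i, j)) = 1" if "i < 6" "j < 6" for i j
    using unit[OF that] by (simp add: complex_norm_square[symmetric])
  have Hd: "H $$ (\<sigma> i, \<sigma> i) = (if i \<in> {1, 2, 3} then - 1 else 1)" if "i < 6" for i
    using diag[OF lt[OF that]] \<sigma>(2) that by (auto simp: less_6_cases)
  have "\<exists>\<theta> \<in> {- pi .. - arccos ((- 1 + sqrt 3) / 2)} \<union> {arccos ((- 1 + sqrt 3) / 2) .. pi}.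
           monomially_equiv 6 K (H_family \<theta>)"
  proof (rule normalised_hadamard_equiv_H_family)
    show "complex_hadamard 6 K" using complex_hadamard_monomial[OF assms(1) eq] .
    show "K $$ (j, i) = cnj (K $$ (i, j))" if "i < 6" "j < 6" for i j
      using that adj[OF lt[OF that(1)] lt[OF that(2)]] by (simp add: K_def)
    show "K $$ (0, j) = 1" if "j < 6" for j
      using that Hd[of 0] Hu[of "\<sigma> 0" "\<sigma> j"] lt by (simp add: K_def)
    show "K $$ (i, i) = (if i \<in> {1, 2, 3} then - 1 else 1)" if "i < 6" for i
    proof -
      have "K $$ (i, i) = H $$ (\<sigma> i, \<sigma> i) * (H $$ (\<sigma> 0, \<sigma> i) * cnj (H $$ (\<sigma> 0, \<sigma> i)))"
        using that by (simp add: K_def)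
      then show ?thesis using Hu[of "\<sigma> 0" "\<sigma> i"] Hd[OF that] lt that by simp
    qed
  qed
  then show ?thesis
    using hadamard_equiv_monomial[OF assms(1) monomially_equiv_trans[OF eq]] by blast
qed

end
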